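(* Let $t \ge 1$ be an integer and let $D$ be a finite Eulerian digraph (loops and multiple edges allowed) which does not contain an immersion of $\vec{K}_t$, the complete digraph of order $t$. Then there exists a laminar family of edge-cuts of $D$, each of size $< 2t(t-1)$, such that every block of the resulting partition of $V(D)$ has size less than $t$.
   Context: All digraphs are finite and may have loops and multiple edges. A digraph is Eulerian if every vertex has in-degree equal to its out-degree (connectedness is not required). $\vec{K}_t$ denotes the complete digraph of order $t$: it has $t$ vertices and a digon (a pair of oppositely oriented edges) between each pair of distinct vertices. Immersion: a digraph $F$ is immersed in a digraph $D$ (equivalently, $D$ contains an immersion of $F$) if there is an injective function $\phi: V(F)\to V(D)$ and, for each edge $uv\in E(F)$ (directed from $u$ to $v$), a directed path $P_{uv}$ in $D$ from $\phi(u)$ to $\phi(v)$, such that the paths $P_{uv}$, $uv\in E(F)$, are pairwise edge-disjoint. Edge-cuts: for $X\subseteq V(D)$, $\delta(X)$ denotes the edge-cut of $D$ consisting of all edges between $X$ and $V(D)\setminus X$, in both directions; its size is the number of these edges, counted with multiplicity. An edge-cut is regarded together with its associated vertex partition $\{X, V(D)\setminus X\}$ (this matters when $D$ is disconnected, where the edge set $\delta(X)$ does not determine the partition). The edge-cut $\delta(X)$ separates $x,y\in V(D)$ if exactly one of $x,y$ lies in $X$. Laminar families: two edge-cuts $\delta(X)$ and $\delta(Y)$ in a connected digraph $D$ (i.e. with connected underlying graph) are uncrossed if either $X$ or $V(D)\setminus X$ is contained in either $Y$ or $V(D)\setminus Y$. In a general digraph, two edge-cuts are uncrossed if this holds in each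 component, i.e. for every component $C$ of (the underlying graph of) $D$, one of $X\cap V(C)$, $V(C)\setminus X$ is contained in one of $Y\cap V(C)$, $V(C)\setminus Y$. A family of pairwise uncrossed edge-cuts is called laminar. Resulting partition: a family of edge-cuts of $D$ yields a partition of $V(D)$ in which two vertices lie in the same block if and only if no edge-cut of the family separates them. The size of a block is its number of vertices. *)

theory Defs
  imports "Graph_Theory.Graph_Theory"
begin

definition eulerian :: "('a, 'b) pre_digraph \<Rightarrow> bool" where
  "eulerian D \<longleftrightarrow> (\<forall>v \<in> verts D. in_degree D v = out_degree D v)"

text \<open>
  Paths do not repeat vertices, so a loop of \<open>F\<close> imposes no condition in the following
  definition (its path is empty). This is immaterial for complete digraphs, which are loopless.
\<close>

definition immersed :: "('c, 'd) pre_digraph \<Rightarrow> ('a, 'b) pre_digraph \<Rightarrow> bool" where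
  "immersed F D \<longleftrightarrow> (\<exists>\<phi> P. inj_on \<phi> (verts F) \<and> \<phi> ` verts F \<subseteq> verts D \<and>
     (\<forall>e \<in> arcs F. pre_digraph.apath D (\<phi> (tail F e)) (P e) (\<phi> (head F e))) \<and>
     (\<forall>e \<in> arcs F. \<forall>e' \<in> arcs F. e \<noteq> e' \<longrightarrow> set (P e) \<inter> set (P e') = {}))"

text \<open>
  An edge-cut comes with its vertex partition \<open>{X, V(D) - X}\<close>, so we represent it by one of its
  sides \<open>X \<subseteq> V(D)\<close>, and a family of edge-cuts by a set of such sides. None of the notions below
  depends on which of the two sides is chosen.
\<close>

definition edge_cut :: "('a, 'b) pre_digraph \<Rightarrow> 'a set \<Rightarrow> 'b set" where
  "edge_cut D X = {e \<in> arcs D. tail D e \<in> X \<and> head D e \<in> verts D - X \<or>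
                               tail D e \<in> verts D - X \<and> head D e \<in> X}"

definition separates :: "'a set \<Rightarrow> 'a \<Rightarrow> 'a \<Rightarrow> bool" where
  "separates X x y \<longleftrightarrow> (x \<in> X) \<noteq> (y \<in> X)"

text \<open>\<^const>\<open>connected\<close> refers to the underlying undirected graph.\<close>

definition component :: "('a, 'b) pre_digraph \<Rightarrow> ('a, 'b) pre_digraph \<Rightarrow> bool" where
  "component D C \<longleftrightarrow> pre_digraph.max_subgraph D connected C"

definition uncrossed :: "('a, 'b) pre_digraph \<Rightarrow> 'a set \<Rightarrow> 'a set \<Rightarrow> bool" where
  "uncrossed D X Y \<longleftrightarrow> (\<forall>C. component D C \<longrightarrow>
     (\<exists>A \<in> {X \<inter> verts C, verts C - X}. \<exists>B \<in> {Y \<inter> verts C, verts C - Y}. A \<subseteq> B))"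

definition laminar :: "('a, 'b) pre_digraph \<Rightarrow> 'a set set \<Rightarrow> bool" where
  "laminar D \<F> \<longleftrightarrow> (\<forall>X \<in> \<F>. \<forall>Y \<in> \<F>. uncrossed D X Y)"

definition resulting_partition :: "('a, 'b) pre_digraph \<Rightarrow> 'a set set \<Rightarrow> 'a set set" where
  "resulting_partition D \<F> =
     verts D // {(x, y). x \<in> verts D \<and> y \<in> verts D \<and> (\<forall>X \<in> \<F>. \<not> separates X x y)}"

end

theory Submission
  imports Defs
begin

text \<open>
  If every edge-cut separating the images of two vertices of an Eulerian digraph \<open>F\<close> in the
  Eulerian digraph \<open>D\<close> has at least \<open>|E(F)|\<close> edges in each direction, then \<open>F\<close> is immersed in
  \<open>D\<close>. Indeed, fix a hub \<open>r\<close> among the images. By max-flow min-cut there are edge-disjoint paths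
  to \<open>r\<close>, one from the image of the tail of each edge of \<open>F\<close>. As \<open>D\<close> and \<open>F\<close> are
  Eulerian, the unused edges of \<open>D\<close> automatically decompose into cycles and paths from \<open>r\<close> to the
  images of the heads of the edges of \<open>F\<close>; concatenate the two families at \<open>r\<close>.

  Hence no \<open>t\<close> vertices are pairwise inseparable by cuts of size \<open>< 2t(t - 1)\<close>. A maximal
  cross-free family of small cuts, each minimum for some pair of vertices, separates all pairs
  that can be separated by small cuts, by the uncrossing argument of Gomory and Hu.
\<close>

section \<open>Uncrossing\<close>

text \<open>The disjuncts say that one of the four corners of \<open>X\<close> and \<open>Y\<close>
  in \<open>V\<close> is empty. This is required on all of \<open>V\<close> rather than in each
  component; it is stronger than \<open>uncrossed\<close> and lets the uncrossing ignore
  components.\<close>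

definition cross_free :: "'a set \<Rightarrow> 'a set \<Rightarrow> 'a set \<Rightarrow> bool" where
  "cross_free V X Y \<longleftrightarrow> X \<inter> Y = {} \<or> X \<subseteq> Y \<or> Y \<subseteq> X \<or> X \<union> Y = V"

lemma cross_free_sym: "cross_free V X Y \<longleftrightarrow> cross_free V Y X"
  unfolding cross_free_def by blast

lemma cross_free_Compl:
  assumes "X \<subseteq> V" "Y \<subseteq> V"
  shows "cross_free V (V - X) Y \<longleftrightarrow> cross_free V X Y"
  using assms unfolding cross_free_def by blast

text \<open>The only combination not settled directly is \<open>Z\<close> lying inside one of
  \<open>X\<close>, \<open>Y\<close> and covering \<open>V\<close> together with the other. It
  forces \<open>X \<union> Y = V\<close>, which the crossing of \<open>X\<close> and
  \<open>Y\<close> excludes.\<close>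

lemma cross_free_Int:
  assumes "X \<subseteq> V" "Y \<subseteq> V" "Z \<subseteq> V" "\<not> cross_free V X Y" "cross_free V Z X" "cross_free V Z Y"
  shows "cross_free V Z (X \<inter> Y)"
  using assms unfolding cross_free_def by blast

lemma separates_Compl:
  assumes "x \<in> V" "y \<in> V"
  shows "separates (V - X) x y \<longleftrightarrow> separates X x y"
  using assms by (auto simp: separates_def)

definition min_cut :: "'a set \<Rightarrow> ('a set \<Rightarrow> nat) \<Rightarrow> 'a \<Rightarrow> 'a \<Rightarrow> 'a set \<Rightarrow> bool" where
  "min_cut V d x y X \<longleftrightarrow>
     X \<subseteq> V \<and> separates X x y \<and> (\<forall>Z \<subseteq> V. separates Z x y \<longrightarrow> d X \<le> d Z)"

lemma min_cut_Compl:
  assumes "\<And>X. X \<subseteq> V \<Longrightarrow> d (V - X) = d X" "x \<in> V" "y \<in> V" "min_cut V d x y X"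
  shows "min_cut V d x y (V - X)"
  using assms by (auto simp: min_cut_def separates_Compl)

text \<open>A suitable corner of \<open>X\<close> and \<open>Y\<close> replaces \<open>Y\<close>: if
  the opposite corner still separates \<open>u\<close> from \<open>v\<close>, submodularity makes
  the first no larger than \<open>Y\<close>. The last conclusion ensures that the replacement
  creates no new crossings.\<close>

lemma min_cut_uncross:
  fixes d :: "'a set \<Rightarrow> nat"
  assumes sym: "\<And>X. X \<subseteq> V \<Longrightarrow> d (V - X) = d X"
    and submod: "\<And>X Y. X \<subseteq> V \<Longrightarrow> Y \<subseteq> V \<Longrightarrow> d (X \<inter> Y) + d (X \<union> Y) \<le> d X + d Y"
    and uv: "u \<in> V" "v \<in> V" and X: "min_cut V d u v X"
    and xy: "x \<in> V" "y \<in> V" and Y: "min_cut V d x y Y"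
    and nsep: "\<not> separates X x y" and cross: "\<not> cross_free V X Y"
  obtains Y' where "min_cut V d x y Y'" "cross_free V X Y'"
    "\<And>Z. Z \<subseteq> V \<Longrightarrow> cross_free V Z X \<Longrightarrow> cross_free V Z Y \<Longrightarrow> cross_free V Z Y'"
proof -
  have XV: "X \<subseteq> V" and YV: "Y \<subseteq> V" using X Y by (auto simp: min_cut_def)
  \<comment> \<open>The side of \<open>X\<close> that contains \<open>x\<close> also contains
    \<open>y\<close>, as \<open>X\<close> does not separate them.\<close>
  define X1 where "X1 = (if x \<in> X then X else V - X)"
  have X1: "min_cut V d u v X1" "X1 \<subseteq> V" "x \<in> X1" "y \<in> X1"
    using X XV xy nsep min_cut_Compl[OF sym uv X] by (auto simp: X1_def separates_def)
  have cfX1: "cross_free V Z X1 \<longleftrightarrow> cross_free V Z X" if "Z \<subseteq> V" for Z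
    using that XV cross_free_Compl cross_free_sym by (metis X1_def)
  obtain w w' where w: "w \<in> X1" "w' \<notin> X1" "{w, w'} = {u, v}"
    using X1(1) by (auto simp: min_cut_def separates_def)
  \<comment> \<open>Of \<open>u\<close> and \<open>v\<close>, \<open>w'\<close> is the one outside
    \<open>X1\<close>. The side of \<open>Y\<close> is chosen to avoid \<open>w'\<close> too, so
    that \<open>X1 \<union> Y1\<close> separates \<open>w\<close> from \<open>w'\<close>.\<close>
  define Y1 where "Y1 = (if w' \<in> Y then V - Y else Y)"
  have Y1: "min_cut V d x y Y1" "Y1 \<subseteq> V" "w' \<notin> Y1"
    using Y YV min_cut_Compl[OF sym xy Y] by (auto simp: Y1_def)
  have cfY1: "cross_free V Z Y1 \<longleftrightarrow> cross_free V Z Y" if "Z \<subseteq> V" for Z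
    using that YV cross_free_Compl cross_free_sym by (metis Y1_def)
  have cross1: "\<not> cross_free V X1 Y1"
    using cross cfX1[OF YV] cfY1[OF X1(2)] cross_free_sym by metis
  have "separates (X1 \<union> Y1) u v" using w Y1(3) by (auto simp: separates_def doubleton_eq_iff)
  hence "d X1 \<le> d (X1 \<union> Y1)" using X1 Y1 by (auto simp: min_cut_def)
  hence le: "d (X1 \<inter> Y1) \<le> d Y1" using submod[OF X1(2) Y1(2)] by linarith
  have "separates (X1 \<inter> Y1) x y" using X1 Y1(1) by (auto simp: min_cut_def separates_def)
  hence "min_cut V d x y (X1 \<inter> Y1)"
    using Y1 le by (auto simp: min_cut_def intro: order_trans)
  moreover have "cross_free V X (X1 \<inter> Y1)"
    by (auto simp: cross_free_def X1_def)
  moreover have "cross_free V Z (X1 \<inter> Y1)"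
    if "Z \<subseteq> V" "cross_free V Z X" "cross_free V Z Y" for Z
    using that cross_free_Int[OF X1(2) Y1(2) that(1) cross1] cfX1 cfY1 by blast
  ultimately show ?thesis using that by blast
qed

lemma cross_free_family_separating:
  fixes d :: "'a set \<Rightarrow> nat"
  assumes fin: "finite V"
    and sym: "\<And>X. X \<subseteq> V \<Longrightarrow> d (V - X) = d X"
    and submod: "\<And>X Y. X \<subseteq> V \<Longrightarrow> Y \<subseteq> V \<Longrightarrow> d (X \<inter> Y) + d (X \<union> Y) \<le> d X + d Y"
  obtains \<F> where "\<F> \<subseteq> Pow V" "\<forall>X \<in> \<F>. \<forall>Y \<in> \<F>. cross_free V X Y" "\<forall>X \<in> \<F>. d X < k"
    "\<And>x y X. x \<in> V \<Longrightarrow> y \<in> V \<Longrightarrow> X \<subseteq> V \<Longrightarrow> d X < k \<Longrightarrow> separates X x y \<Longrightarrow>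
       \<exists>X \<in> \<F>. separates X x y"
proof -
  \<comment> \<open>Being minimum for some pair is part of the invariant so that every member can
    serve as the \<open>X\<close> of \<open>min_cut_uncross\<close>.\<close>
  define good where "good \<F> \<longleftrightarrow> \<F> \<subseteq> Pow V \<and> (\<forall>X \<in> \<F>. \<forall>Y \<in> \<F>. cross_free V X Y) \<and>
    (\<forall>X \<in> \<F>. d X < k \<and> (\<exists>u \<in> V. \<exists>v \<in> V. min_cut V d u v X))" for \<F>
  have "finite {\<F>. good \<F>}"
    by (rule finite_subset[of _ "Pow (Pow V)"]) (use fin in \<open>auto simp: good_def\<close>)
  moreover have "good {}" by (simp add: good_def)
  ultimately obtain \<F> where good: "good \<F>" and max: "\<And>\<G>. good \<G> \<Longrightarrow> \<F> \<subseteq> \<G> \<Longrightarrow> \<F> = \<G>"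
    using finite_has_maximal[of "{\<F>. good \<F>}"] by auto
  have finF: "finite \<F>"
    by (rule finite_subset[of _ "Pow V"]) (use good fin in \<open>auto simp: good_def\<close>)
  have "\<exists>X \<in> \<F>. separates X x y"
    if xy: "x \<in> V" "y \<in> V" and X0: "X0 \<subseteq> V" "d X0 < k" "separates X0 x y" for x y X0
  proof (rule ccontr)
    assume nsep: "\<not> (\<exists>X \<in> \<F>. separates X x y)"
    define crossing where "crossing Y = {X \<in> \<F>. \<not> cross_free V X Y}" for Y
    obtain Y0 where "min_cut V d x y Y0"
      using exists_least_iff[of "\<lambda>n. \<exists>Z \<subseteq> V. separates Z x y \<and> d Z = n"] X0
      unfolding min_cut_def by (metis linorder_not_le)
    \<comment> \<open>Among the minimum cuts for \<open>x\<close> and \<open>y\<close>, one with the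
      fewest crossings with \<open>\<F>\<close>. With none it could be added to the maximal family;
      otherwise uncrossing with some \<open>X\<close> removes that crossing and adds none.\<close>
    then obtain Y where Y: "min_cut V d x y Y"
      and least: "\<And>Z. min_cut V d x y Z \<Longrightarrow> card (crossing Y) \<le> card (crossing Z)"
      using ex_has_least_nat[of "min_cut V d x y" Y0 "\<lambda>Z. card (crossing Z)"] by blast
    have YV: "Y \<subseteq> V" and sepY: "separates Y x y" and "d Y \<le> d X0"
      using Y X0 by (auto simp: min_cut_def)
    hence dY: "d Y < k" using X0 by simp
    show False
    proof (cases "crossing Y = {}")
      case True
      hence "cross_free V X Y" "cross_free V Y X" if "X \<in> \<F>" for X
        using that cross_free_sym[of V X Y] by (auto simp: crossing_def)
      moreover have "cross_free V Y Y" by (simp add: cross_free_def)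
      ultimately have "good (insert Y \<F>)"
        using good YV dY Y xy unfolding good_def by auto
      with max[of "insert Y \<F>"] have "Y \<in> \<F>" by blast
      with nsep sepY show False by blast
    next
      case False
      then obtain X where X: "X \<in> \<F>" "\<not> cross_free V X Y" by (auto simp: crossing_def)
      then obtain u v where uv: "u \<in> V" "v \<in> V" "min_cut V d u v X"
        using good by (auto simp: good_def)
      obtain Y' where Y': "min_cut V d x y Y'" "cross_free V X Y'"
        "\<And>Z. Z \<subseteq> V \<Longrightarrow> cross_free V Z X \<Longrightarrow> cross_free V Z Y \<Longrightarrow> cross_free V Z Y'"
        using min_cut_uncross[OF sym submod uv xy Y _ X(2)] nsep X(1) by blast
      have "Z \<subseteq> V" "cross_free V Z X" if "Z \<in> \<F>" for Z
        using good X(1) that by (auto simp: good_def)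
      hence "crossing Y' \<subseteq> crossing Y" using Y'(3) by (auto simp: crossing_def)
      moreover have "X \<in> crossing Y" "X \<notin> crossing Y'"
        using X Y'(2) by (auto simp: crossing_def)
      ultimately have "crossing Y' \<subset> crossing Y" by blast
      hence "card (crossing Y') < card (crossing Y)"
        using finF by (intro psubset_card_mono) (auto simp: crossing_def)
      with least[OF Y'(1)] show False by simp
    qed
  qed
  thus ?thesis using good that[of \<F>] unfolding good_def by simp
qed

section \<open>Integral flows\<close>

text \<open>Net outflow of \<open>A\<close> from \<open>X\<close>; arcs inside \<open>X\<close>
  cancel. The end maps are free parameters, so the same formula also describes demands, such as the
  edges of \<open>F\<close> placed in \<open>D\<close> or sent to a hub.\<close>

definition net :: "('b \<Rightarrow> 'a) \<Rightarrow> ('b \<Rightarrow> 'a) \<Rightarrow> 'b set \<Rightarrow> 'a set \<Rightarrow> int" where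
  "net s d A X = (\<Sum>a\<in>A. of_bool (s a \<in> X) - of_bool (d a \<in> X))"

lemma net_sum_singletons:
  assumes "finite X"
  shows "(\<Sum>v\<in>X. net s d A {v}) = net s d A X"
proof -
  have "(\<Sum>v\<in>X. of_bool (w \<in> {v}) :: int) = of_bool (w \<in> X)" for w
    using assms by (simp add: of_bool_def)
  thus ?thesis unfolding net_def
    by (subst sum.swap) (simp add: sum_subtractf)
qed

lemma net_Diff:
  assumes "finite A" "B \<subseteq> A"
  shows "net s d (A - B) X = net s d A X - net s d B X"
  using assms by (simp add: net_def sum_diff)

lemma net_closed:
  assumes "\<And>a. a \<in> A \<Longrightarrow> s a \<in> X \<and> d a \<in> X"
  shows "net s d A X = 0"
  using assms by (simp add: net_def)

lemma net_singleton_eq_card: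
  assumes "finite A"
  shows "net s d A {v} = int (card {a \<in> A. s a = v}) - int (card {a \<in> A. d a = v})"
  using assms by (simp add: net_def sum_subtractf of_bool_def sum.If_cases Int_def)

definition out_cut :: "('a, 'b) pre_digraph \<Rightarrow> 'a set \<Rightarrow> 'b set" where
  "out_cut D X = {a \<in> arcs D. tail D a \<in> X \<and> head D a \<notin> X}"

text \<open>The sum telescopes along the walk. Distinctness makes the set of arcs count each step
  exactly once.\<close>

lemma (in pre_digraph) cas_net:
  assumes "cas u p v" "distinct p"
  shows "net (tail G) (head G) (set p) {w} = of_bool (u = w) - of_bool (v = w)"
  using assms
proof (induction p arbitrary: u)
  case Nil
  thus ?case by (simp add: net_def)
next
  case (Cons a p)
  thus ?case using Cons.IH[of "head G a"] by (auto simp: net_def)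
qed

lemma (in wf_digraph) apath_distinct:
  assumes "apath u p v"
  shows "distinct p"
  using assms by (auto simp: apath_def awalk_verts_conv distinct_map split: if_splits)

text \<open>The integral feasibility theorem of Gale, for unit capacities.\<close>

lemma (in fin_digraph) unit_flow_exists:
  fixes b :: "'a \<Rightarrow> int"
  assumes total: "(\<Sum>v\<in>verts G. b v) = 0"
    and cut: "\<And>X. X \<subseteq> verts G \<Longrightarrow> (\<Sum>v\<in>X. b v) \<le> int (card (out_cut G X))"
  obtains A where "A \<subseteq> arcs G" "\<And>v. v \<in> verts G \<Longrightarrow> net (tail G) (head G) A {v} = b v"
proof -
  define e where "e A v = net (tail G) (head G) A {v}" for A v
  define dev where "dev A = (\<Sum>v\<in>verts G. nat \<bar>e A v - b v\<bar>)" for A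
  \<comment> \<open>An arc set with least total deviation from \<open>b\<close>. Any remaining
    deviation leads to an augmenting path or to a cut violating the hypothesis.\<close>
  obtain A where A: "A \<subseteq> arcs G" and least: "\<And>B. B \<subseteq> arcs G \<Longrightarrow> dev A \<le> dev B"
    using ex_has_least_nat[of "\<lambda>A. A \<subseteq> arcs G" "{}" dev] by blast
  have finA: "finite A" using A finite_arcs finite_subset by blast
  have "e A v = b v" if "v \<in> verts G" for v
  proof (rule ccontr)
    assume "e A v \<noteq> b v"
    have "(\<Sum>v\<in>verts G. e A v - b v) = 0"
      using total A by (simp add: sum_subtractf e_def net_sum_singletons net_closed subset_iff)
    hence "\<not> (\<forall>x\<in>verts G. 0 \<le> e A x - b x)"
      using \<open>e A v \<noteq> b v\<close> that sum_nonneg_eq_0_iff[of "verts G" "\<lambda>v. e A v - b v"] by auto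
    then obtain x where x: "x \<in> verts G" "e A x < b x" by auto
    \<comment> \<open>The residual digraph: arcs of \<open>A\<close> are reversed, the others kept.
      Arc names do not change, so a path of \<open>R\<close> is also a set of arcs of
      \<open>G\<close>.\<close>
    define R where "R = G\<lparr>tail := \<lambda>a. if a \<in> A then head G a else tail G a,
                          head := \<lambda>a. if a \<in> A then tail G a else head G a\<rparr>"
    interpret R: fin_digraph R
      by unfold_locales (auto simp: R_def)
    define X where "X = {y. x \<rightarrow>\<^sup>*\<^bsub>R\<^esub> y}"
    have XV: "X \<subseteq> verts G" using R.reachable_in_verts by (auto simp: X_def R_def)
    hence finX: "finite X" using finite_verts finite_subset by blast
    have "x \<in> X" using x R.reachable_refl[of x] by (simp add: X_def R_def)
    have step: "head R a \<in> X" if "a \<in> arcs G" "tail R a \<in> X" for a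
      using that R.reachable_adj_trans[of x "tail R a" "head R a"]
      by (auto simp: X_def arcs_ends_conv R_def)
    show False
    proof (cases "\<exists>y\<in>X. b y < e A y")
      case True
      then obtain y where y: "y \<in> X" "b y < e A y" by blast
      then obtain p where p: "R.apath x p y" using R.reachable_apath by (auto simp: X_def)
      have dp: "distinct p" by (rule R.apath_distinct) fact
      have "set p \<subseteq> arcs R" and casp: "R.cas x p y"
        using p by (auto simp: R.apath_def R.awalk_def)
      hence pA: "set p \<subseteq> arcs G" by (simp add: R_def)
      \<comment> \<open>Augmentation along \<open>p\<close>: by symmetric difference, the deficient
        \<open>x\<close> gains one unit of outflow, the surplus vertex \<open>y\<close> loses one,
        and all other vertices keep theirs.\<close>
      define B where "B = (A - set p) \<union> (set p - A)"
      have BG: "B \<subseteq> arcs G" using A pA by (auto simp: B_def)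
      have eB: "e B w = e A w + of_bool (x = w) - of_bool (y = w)" for w
      proof -
        let ?n = "net (tail G) (head G)"
        have "?n B {w} = ?n (A - set p) {w} + ?n (set p - A) {w}"
          unfolding B_def net_def using finA by (intro sum.union_disjoint) auto
        also have "?n (A - set p) {w} = ?n A {w} - ?n (A \<inter> set p) {w}"
          using net_Diff[OF finA, of "A \<inter> set p"] by (simp add: Diff_Int2 Diff_Int)
        also have "?n (set p - A) {w} = net (tail R) (head R) (set p - A) {w}"
          unfolding net_def by (intro sum.cong) (auto simp: R_def)
        also have "?n (A \<inter> set p) {w} = - net (tail R) (head R) (A \<inter> set p) {w}"
          unfolding net_def sum_negf[symmetric] by (intro sum.cong) (auto simp: R_def)
        also have "?n A {w} - (- net (tail R) (head R) (A \<inter> set p) {w})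
            + net (tail R) (head R) (set p - A) {w} = ?n A {w} + net (tail R) (head R) (set p) {w}"
          using net_Diff[of "set p" "A \<inter> set p" "tail R" "head R" "{w}"]
          by (simp add: Diff_Int)
        finally show ?thesis using R.cas_net[OF casp dp] by (simp add: e_def)
      qed
      have "dev B < dev A" unfolding dev_def
      proof (rule sum_strict_mono_ex1)
        show "\<forall>v\<in>verts G. nat \<bar>e B v - b v\<bar> \<le> nat \<bar>e A v - b v\<bar>"
          using x y by (auto simp: eB)
        show "\<exists>v\<in>verts G. nat \<bar>e B v - b v\<bar> < nat \<bar>e A v - b v\<bar>"
          using x y by (intro bexI[of _ x]) (auto simp: eB)
      qed simp
      with least[OF BG] show False by simp
    next
      case False
      \<comment> \<open>As \<open>X\<close> is closed in \<open>R\<close>, no arc of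
        \<open>A\<close> enters \<open>X\<close> and every arc leaving \<open>X\<close> is in
        \<open>A\<close>. Hence the net outflow of \<open>X\<close> is the whole
        \<open>out_cut\<close>, although no vertex of \<open>X\<close> has a surplus and
        \<open>x\<close> has a deficit.\<close>
      have "net (tail G) (head G) A X =
          (\<Sum>a\<in>A. of_bool (tail G a \<in> X \<and> head G a \<notin> X))"
        unfolding net_def
      proof (rule sum.cong)
        fix a assume "a \<in> A"
        thus "of_bool (tail G a \<in> X) - of_bool (head G a \<in> X)
            = (of_bool (tail G a \<in> X \<and> head G a \<notin> X) :: int)"
          using step[of a] A by (auto simp: R_def)
      qed simp
      also have "\<dots> = int (card {a \<in> A. tail G a \<in> X \<and> head G a \<notin> X})"
        using finA by (simp add: of_bool_def sum.If_cases Int_def)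
      also have "{a \<in> A. tail G a \<in> X \<and> head G a \<notin> X} = out_cut G X"
        using step A by (fastforce simp: out_cut_def R_def split: if_splits)
      finally have "(\<Sum>v\<in>X. b v) \<le> (\<Sum>v\<in>X. e A v)"
        using cut[OF XV] finX by (simp add: e_def net_sum_singletons)
      moreover have "(\<Sum>v\<in>X. e A v) < (\<Sum>v\<in>X. b v)"
        using False x \<open>x \<in> X\<close> finX by (intro sum_strict_mono_ex1) (auto simp: not_less)
      ultimately show False by simp
    qed
  qed
  with A that show ?thesis by (auto simp: e_def)
qed

text \<open>Walks are peeled off one demand at a time. A common start or a common end makes this a
  single-commodity problem, so an arbitrary demand can be routed first. Equality of
  \<open>net\<close> allows \<open>A\<close> to contain further cycles, which are left over.\<close>

lemma (in fin_digraph) flow_path_decomposition: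
  assumes "finite I" "A \<subseteq> arcs G"
    and "\<And>v. v \<in> verts G \<Longrightarrow> net (tail G) (head G) A {v} = net s d I {v}"
    and "\<And>i. i \<in> I \<Longrightarrow> s i \<in> verts G"
    and "(\<exists>r. \<forall>i\<in>I. s i = r) \<or> (\<exists>r. \<forall>i\<in>I. d i = r)"
  shows "\<exists>P. (\<forall>i\<in>I. awalk (s i) (P i) (d i) \<and> set (P i) \<subseteq> A) \<and>
             (\<forall>i\<in>I. \<forall>j\<in>I. i \<noteq> j \<longrightarrow> set (P i) \<inter> set (P j) = {})"
  using assms
proof (induction I arbitrary: A rule: finite_induct)
  case empty
  thus ?case by simp
next
  case (insert j I)
  have finA: "finite A" using insert.prems(1) finite_arcs finite_subset by blast
  define X where "X = {v. \<exists>p. awalk (s j) p v \<and> set p \<subseteq> A}"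
  have XV: "X \<subseteq> verts G" by (auto simp: X_def awalk_last_in_verts)
  hence finX: "finite X" using finite_verts finite_subset by blast
  have sX: "s j \<in> X" using insert.prems(3)
    by (auto simp: X_def awalk_Nil_iff intro!: exI[of _ "[]"])
  have closed: "head G a \<in> X" if a: "a \<in> A" "tail G a \<in> X" for a
  proof -
    obtain p where "awalk (s j) p (tail G a)" "set p \<subseteq> A" using a unfolding X_def by blast
    hence "awalk (s j) (p @ [a]) (head G a)" "set (p @ [a]) \<subseteq> A"
      using a insert.prems(1) by (auto simp: awalk_simps)
    thus ?thesis unfolding X_def by blast
  qed
  have "d j \<in> X"
  proof (rule ccontr)
    assume dX: "d j \<notin> X"
    have "net (tail G) (head G) A X \<le> 0" unfolding net_def
      using closed by (intro sum_nonpos) auto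
    also have "net (tail G) (head G) A X = net s d (insert j I) X"
      using insert.prems(2) XV
      by (subst (1 2) net_sum_singletons[OF finX, symmetric]) (auto intro!: sum.cong)
    also have "\<dots> = 1 + net s d I X" using insert.hyps sX dX by (simp add: net_def)
    \<comment> \<open>With a common start all starts lie in \<open>X\<close>; with a common end all
      ends equal \<open>d j\<close>, which is outside \<open>X\<close>. Either way no other demand
      enters \<open>X\<close> from outside.\<close>
    also have "net s d I X \<ge> 0" unfolding net_def
      using insert.prems(4) sX dX by (intro sum_nonneg) auto
    finally show False by simp
  qed
  then obtain q where q: "awalk (s j) q (d j)" "set q \<subseteq> A" by (auto simp: X_def)
  \<comment> \<open>Shortcutting to a path makes the arcs distinct, so \<open>cas_net\<close>
    applies to the removed set.\<close>
  define p where "p = awalk_to_apath q"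
  have p: "apath (s j) p (d j)" "set p \<subseteq> A"
    using q awalk_to_apath_subset[OF q(1)] apath_awalk_to_apath by (auto simp: p_def)
  hence wp: "awalk (s j) p (d j)" and dp: "distinct p"
    using apath_distinct by (auto simp: apath_def)
  hence "net (tail G) (head G) (set p) {v} = of_bool (s j = v) - of_bool (d j = v)" for v
    using cas_net by (auto simp: awalk_def)
  hence "net (tail G) (head G) (A - set p) {v} = net s d I {v}" if "v \<in> verts G" for v
    using insert.prems(2)[OF that] insert.hyps by (simp add: net_Diff[OF finA p(2)] net_def[of s])
  moreover have "(\<exists>r. \<forall>i\<in>I. s i = r) \<or> (\<exists>r. \<forall>i\<in>I. d i = r)" using insert.prems(4) by blast
  moreover have "A - set p \<subseteq> arcs G" using insert.prems(1) by blast
  ultimately obtain P where P: "\<forall>i\<in>I. awalk (s i) (P i) (d i) \<and> set (P i) \<subseteq> A - set p"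
      "\<forall>i\<in>I. \<forall>j\<in>I. i \<noteq> j \<longrightarrow> set (P i) \<inter> set (P j) = {}"
    using insert.IH[of "A - set p"] insert.prems(3) by auto
  define P' where "P' = P(j := p)"
  have eq: "P' i = P i" if "i \<in> I" for i using that insert.hyps by (auto simp: P'_def)
  have "awalk (s i) (P' i) (d i) \<and> set (P' i) \<subseteq> A" if "i \<in> insert j I" for i
    using that wp p(2) P(1) eq by (auto simp: P'_def)
  moreover have "set (P' i) \<inter> set (P' i') = {}"
    if ii': "i \<in> insert j I" "i' \<in> insert j I" "i \<noteq> i'" for i i'
  proof -
    have "P' j = p" by (simp add: P'_def)
    moreover have "set p \<inter> set (P' i) = {}" if "i \<in> I" for i
      using that P(1) eq by auto
    moreover have "set (P' i) \<inter> set (P' i') = {}" if "i \<in> I" "i' \<in> I"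
      using that ii'(3) P(2) eq by simp
    ultimately show ?thesis using ii' by (auto simp: Int_commute)
  qed
  ultimately show ?case by blast
qed

section \<open>Immersions in Eulerian digraphs\<close>

lemma (in fin_digraph) eulerian_net:
  assumes "eulerian G" "v \<in> verts G"
  shows "net (tail G) (head G) (arcs G) {v} = 0"
  using assms
  by (simp add: net_singleton_eq_card eulerian_def in_degree_def out_degree_def
      in_arcs_def out_arcs_def)

text \<open>Zero net outflow at each vertex sums to zero net outflow of \<open>X\<close>, so equally
  many arcs cross in each direction. This is the source of the factor 2 in the bound on cut
  sizes.\<close>

lemma (in fin_digraph) eulerian_card_edge_cut:
  assumes "eulerian G" "X \<subseteq> verts G"
  shows "card (edge_cut G X) = 2 * card (out_cut G X)"
proof -
  define I where "I = {a \<in> arcs G. tail G a \<notin> X \<and> head G a \<in> X}"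
  have "net (tail G) (head G) (arcs G) X = 0"
    using assms eulerian_net finite_subset[OF assms(2)]
    by (subst net_sum_singletons[symmetric]) (auto intro!: sum.neutral)
  also have "net (tail G) (head G) (arcs G) X = (\<Sum>a\<in>arcs G.
      of_bool (tail G a \<in> X \<and> head G a \<notin> X) - of_bool (tail G a \<notin> X \<and> head G a \<in> X))"
    unfolding net_def by (intro sum.cong) auto
  also have "\<dots> = int (card (out_cut G X)) - int (card I)"
    by (simp add: sum_subtractf of_bool_def sum.If_cases Int_def out_cut_def I_def)
  finally have "card I = card (out_cut G X)" by simp
  moreover have "edge_cut G X = out_cut G X \<union> I"
    using assms(2) by (auto simp: edge_cut_def out_cut_def I_def)
  moreover have "card (out_cut G X \<union> I) = card (out_cut G X) + card I"
    by (intro card_Un_disjoint) (auto simp: out_cut_def I_def)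
  ultimately show ?thesis by simp
qed

lemma (in fin_digraph) card_edge_cut_eq_sum:
  assumes "X \<subseteq> verts G"
  shows "card (edge_cut G X) = (\<Sum>a\<in>arcs G. of_bool (separates X (tail G a) (head G a)))"
proof -
  have "edge_cut G X = {a \<in> arcs G. separates X (tail G a) (head G a)}"
    using assms by (auto simp: edge_cut_def separates_def)
  thus ?thesis by (simp add: of_bool_def sum.If_cases Int_def)
qed

text \<open>Written as sums over arcs, the inequality holds for each arc separately, by cases on the
  positions of its ends.\<close>

lemma (in fin_digraph) card_edge_cut_submodular:
  assumes "X \<subseteq> verts G" "Y \<subseteq> verts G"
  shows "card (edge_cut G (X \<inter> Y)) + card (edge_cut G (X \<union> Y))
           \<le> card (edge_cut G X) + card (edge_cut G Y)"
proof -
  have "X \<inter> Y \<subseteq> verts G" "X \<union> Y \<subseteq> verts G" using assms by auto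
  thus ?thesis
    unfolding card_edge_cut_eq_sum[OF assms(1)] card_edge_cut_eq_sum[OF assms(2)]
      card_edge_cut_eq_sum[of "X \<inter> Y"] card_edge_cut_eq_sum[of "X \<union> Y"]
      sum.distrib[symmetric]
    by (simp only: card_edge_cut_eq_sum sum.distrib[symmetric], intro sum_mono)
      (auto simp: separates_def)
qed

lemma eulerian_immersed:
  assumes "fin_digraph D" "eulerian D" "fin_digraph F" "eulerian F"
    and inj: "inj_on \<phi> (verts F)" and img: "\<phi> ` verts F \<subseteq> verts D"
    and cut: "\<And>X u v. X \<subseteq> verts D \<Longrightarrow> u \<in> verts F \<Longrightarrow> v \<in> verts F \<Longrightarrow>
                separates X (\<phi> u) (\<phi> v) \<Longrightarrow> card (arcs F) \<le> card (out_cut D X)"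
  shows "immersed F D"
proof (cases "verts F = {}")
  case True
  then have "arcs F = {}" using assms(3) wf_digraph.tail_in_verts[of F]
    by (auto simp: fin_digraph_def)
  with True show ?thesis by (auto simp: immersed_def)
next
  case False
  then obtain u0 where u0: "u0 \<in> verts F" by blast
  interpret D: fin_digraph D by fact
  interpret F: fin_digraph F by fact
  define r where "r = \<phi> u0"
  have phi: "\<phi> u \<in> verts D" if "u \<in> verts F" for u using img that by blast
  have rD: "r \<in> verts D" using phi u0 by (simp add: r_def)
  let ?s = "\<lambda>e. \<phi> (tail F e)" and ?d = "\<lambda>e. \<phi> (head F e)" and ?r = "\<lambda>e. r"
  let ?n = "net (tail D) (head D)"
  \<comment> \<open>The cut condition for routing all tails to \<open>r\<close>. The demand of
    \<open>X\<close> is positive only if \<open>X\<close> contains some tail but not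
    \<open>r\<close>; then \<open>cut\<close> applies, and the demand is at most the number of edges
    of \<open>F\<close>.\<close>
  have le: "net ?s ?r (arcs F) X \<le> int (card (out_cut D X))" if X: "X \<subseteq> verts D" for X
  proof (cases "r \<notin> X \<and> (\<exists>e\<in>arcs F. ?s e \<in> X)")
    case True
    then obtain e where "e \<in> arcs F" "?s e \<in> X" "r \<notin> X" by blast
    hence "card (arcs F) \<le> card (out_cut D X)"
      using X u0 by (intro cut[of X "tail F e" u0]) (auto simp: separates_def r_def)
    moreover have "net ?s ?r (arcs F) X \<le> (\<Sum>e\<in>arcs F. 1)"
      unfolding net_def by (intro sum_mono) auto
    ultimately show ?thesis by simp
  next
    case False
    hence "net ?s ?r (arcs F) X \<le> 0" unfolding net_def by (intro sum_nonpos) auto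
    thus ?thesis by linarith
  qed
  have total: "(\<Sum>v\<in>verts D. net ?s ?r (arcs F) {v}) = 0"
    using phi rD by (simp add: net_sum_singletons net_closed)
  have "(\<Sum>v\<in>X. net ?s ?r (arcs F) {v}) \<le> int (card (out_cut D X))" if "X \<subseteq> verts D" for X
    using le[OF that] finite_subset[OF that] by (simp add: net_sum_singletons)
  from D.unit_flow_exists[OF total this] obtain A where A: "A \<subseteq> arcs D"
    "\<And>v. v \<in> verts D \<Longrightarrow> ?n A {v} = net ?s ?r (arcs F) {v}" by blast
  \<comment> \<open>Injectivity of \<open>\<phi>\<close> carries the balance of \<open>F\<close> at
    \<open>u\<close> to its image; other vertices meet no demand at all.\<close>
  have balanced: "net ?s ?d (arcs F) {v} = 0" for v
  proof (cases "v \<in> \<phi> ` verts F")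
    case True
    then obtain u where u: "u \<in> verts F" "v = \<phi> u" by blast
    have "net ?s ?d (arcs F) {v} = net (tail F) (head F) (arcs F) {u}"
      unfolding net_def using u inj by (intro sum.cong) (auto simp: inj_on_eq_iff)
    thus ?thesis using F.eulerian_net assms(4) u by simp
  next
    case False
    thus ?thesis unfolding net_def by (intro sum.neutral) auto
  qed
  \<comment> \<open>Since \<open>D\<close> is balanced, the complement of \<open>A\<close> has net
    outflow opposite to that of \<open>A\<close>. By \<open>balanced\<close> this is exactly the
    demand from \<open>r\<close> to the heads, so no second flow has to be constructed.\<close>
  have rest: "?n (arcs D - A) {v} = net ?r ?d (arcs F) {v}" if "v \<in> verts D" for v
  proof -
    have "net ?r ?d (arcs F) {v} = net ?s ?d (arcs F) {v} - net ?s ?r (arcs F) {v}"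
      unfolding net_def by (simp add: sum_subtractf)
    thus ?thesis
      using D.eulerian_net[OF assms(2) that] A that balanced by (simp add: net_Diff)
  qed
  obtain P where P: "\<forall>e\<in>arcs F. D.awalk (?s e) (P e) r \<and> set (P e) \<subseteq> A"
      "\<forall>e\<in>arcs F. \<forall>e'\<in>arcs F. e \<noteq> e' \<longrightarrow> set (P e) \<inter> set (P e') = {}"
    using D.flow_path_decomposition[OF F.finite_arcs A(1), of ?s ?r] A(2) phi by auto
  obtain Q where Q: "\<forall>e\<in>arcs F. D.awalk r (Q e) (?d e) \<and> set (Q e) \<subseteq> arcs D - A"
      "\<forall>e\<in>arcs F. \<forall>e'\<in>arcs F. e \<noteq> e' \<longrightarrow> set (Q e) \<inter> set (Q e') = {}"
    using D.flow_path_decomposition[OF F.finite_arcs, of "arcs D - A" ?r ?d] rest rD by auto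
  \<comment> \<open>The concatenation may repeat vertices and is shortened to a path. Disjointness
    survives, since every \<open>P e\<close> stays in \<open>A\<close> and every \<open>Q e\<close>
    outside it.\<close>
  define W where "W e = D.awalk_to_apath (P e @ Q e)" for e
  have W: "D.apath (?s e) (W e) (?d e)" "set (W e) \<subseteq> set (P e) \<union> set (Q e)"
    if "e \<in> arcs F" for e
  proof -
    have pq: "D.awalk (?s e) (P e @ Q e) (?d e)"
      using P(1) Q(1) that by (blast intro: D.awalk_appendI)
    thus "D.apath (?s e) (W e) (?d e)" "set (W e) \<subseteq> set (P e) \<union> set (Q e)"
      using D.apath_awalk_to_apath[OF pq] D.awalk_to_apath_subset[OF pq] by (simp_all add: W_def)
  qed
  have "set (W e) \<inter> set (W e') = {}" if e: "e \<in> arcs F" "e' \<in> arcs F" "e \<noteq> e'" for e e'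
  proof -
    have "set (P e) \<inter> set (Q e') = {}" "set (P e') \<inter> set (Q e) = {}"
      using P(1) Q(1) e by blast+
    thus ?thesis using W(2)[OF e(1)] W(2)[OF e(2)] P(2) Q(2) e by blast
  qed
  thus ?thesis unfolding immersed_def using inj img W(1) by blast
qed

section \<open>Complete digraphs and the conclusion\<close>

lemma complete_digraph_eulerian:
  assumes "complete_digraph t K"
  shows "eulerian K" "card (arcs K) = t * (t - 1)"
proof -
  interpret K: graph K using assms by (simp add: complete_digraph_def)
  have card: "card (verts K) = t"
    using assms by (simp add: complete_digraph_def)
  \<comment> \<open>There are no parallel arcs, so arcs can be counted through their pairs of
    ends.\<close>
  note inj = K.inj_on_arc_to_ends
  have arc: "\<exists>a. a \<in> arcs K \<and> tail K a = u \<and> head K a = v"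
    if "u \<in> verts K" "v \<in> verts K" "u \<noteq> v" for u v
  proof -
    have "(u, v) \<in> arcs_ends K" using assms that by (simp add: complete_digraph_def)
    thus ?thesis by (auto simp: arcs_ends_conv)
  qed
  have "card (out_arcs K v) = t - 1" "card (in_arcs K v) = t - 1" if v: "v \<in> verts K" for v
  proof -
    have "arc_to_ends K ` out_arcs K v = Pair v ` (verts K - {v})"
      using arc[OF v] K.no_loops by (fastforce simp: image_iff arc_to_ends_def)
    hence "card (arc_to_ends K ` out_arcs K v) = t - 1"
      using v card by (simp add: card_image inj_on_def)
    thus "card (out_arcs K v) = t - 1"
      using card_image[OF inj_on_subset[OF inj]] by (metis out_arcs_in_arcs subsetI)
    have "arc_to_ends K ` in_arcs K v = (\<lambda>u. (u, v)) ` (verts K - {v})"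
      using arc[OF _ v] K.no_loops by (fastforce simp: image_iff arc_to_ends_def)
    hence "card (arc_to_ends K ` in_arcs K v) = t - 1"
      using v card by (simp add: card_image inj_on_def)
    thus "card (in_arcs K v) = t - 1"
      using card_image[OF inj_on_subset[OF inj]] by (metis in_arcs_in_arcs subsetI)
  qed
  note deg = this
  show "eulerian K" using deg by (simp add: eulerian_def in_degree_def out_degree_def)
  have "arcs K = (\<Union>v\<in>verts K. out_arcs K v)" by auto
  also have "card \<dots> = (\<Sum>v\<in>verts K. card (out_arcs K v))"
    by (intro card_UN_disjoint) auto
  finally show "card (arcs K) = t * (t - 1)" using deg card by simp
qed

text \<open>Each empty corner yields one containment after restriction to \<open>C\<close>; only the
  case of a union equal to \<open>verts D\<close> needs \<open>C\<close> to lie in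
  \<open>D\<close>.\<close>

lemma cross_free_uncrossed:
  assumes "cross_free (verts D) X Y"
  shows "uncrossed D X Y"
  unfolding uncrossed_def
proof (intro allI impI)
  fix C assume "component D C"
  hence C: "verts C \<subseteq> verts D"
    by (auto simp: component_def pre_digraph.max_subgraph_def subgraph_def)
  consider "X \<inter> Y = {}" | "X \<subseteq> Y" | "Y \<subseteq> X" | "X \<union> Y = verts D"
    using assms unfolding cross_free_def by blast
  thus "\<exists>A\<in>{X \<inter> verts C, verts C - X}. \<exists>B\<in>{Y \<inter> verts C, verts C - Y}. A \<subseteq> B"
  proof cases
    case 1
    hence "X \<inter> verts C \<subseteq> verts C - Y" by blast
    thus ?thesis by simp
  next
    case 2
    hence "X \<inter> verts C \<subseteq> Y \<inter> verts C" by blast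
    thus ?thesis by simp
  next
    case 3
    hence "verts C - X \<subseteq> verts C - Y" by blast
    thus ?thesis by simp
  next
    case 4
    hence "verts C - X \<subseteq> Y \<inter> verts C" using C by blast
    thus ?thesis by simp
  qed
qed

theorem theorem2:
  fixes t :: nat
    and D :: "('a, 'b) pre_digraph"
    and K :: "('c, 'd) pre_digraph"
  assumes "t \<ge> 1"
    and "fin_digraph D"
    and "eulerian D"
    and "complete_digraph t K"
    and "\<not> immersed K D"
  shows "\<exists>\<F>. \<F> \<subseteq> Pow (verts D) \<and> laminar D \<F> \<and>
           (\<forall>X \<in> \<F>. card (edge_cut D X) < 2 * t * (t - 1)) \<and>
           (\<forall>B \<in> resulting_partition D \<F>. card B < t)"
proof -
  interpret D: fin_digraph D by fact
  interpret K: graph K using assms(4) by (simp add: complete_digraph_def)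
  have sym: "card (edge_cut D (verts D - X)) = card (edge_cut D X)" if "X \<subseteq> verts D" for X
  proof -
    have "edge_cut D (verts D - X) = edge_cut D X" using that by (auto simp: edge_cut_def)
    thus ?thesis by simp
  qed
  obtain \<F> where \<F>: "\<F> \<subseteq> Pow (verts D)" "\<forall>X \<in> \<F>. \<forall>Y \<in> \<F>. cross_free (verts D) X Y"
      "\<forall>X \<in> \<F>. card (edge_cut D X) < 2 * t * (t - 1)"
    and sep: "\<And>x y X. x \<in> verts D \<Longrightarrow> y \<in> verts D \<Longrightarrow> X \<subseteq> verts D \<Longrightarrow>
      card (edge_cut D X) < 2 * t * (t - 1) \<Longrightarrow> separates X x y \<Longrightarrow> \<exists>X \<in> \<F>. separates X x y"
    using cross_free_family_separating
      [of "verts D" "\<lambda>X. card (edge_cut D X)" "2 * t * (t - 1)",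
       OF D.finite_verts sym D.card_edge_cut_submodular] by blast
  have "card B < t" if B: "B \<in> resulting_partition D \<F>" for B
  proof (rule ccontr)
    assume "\<not> card B < t"
    then obtain S where S: "S \<subseteq> B" "card S = t" "finite S"
      using obtain_subset_with_card_n[of t B] by (metis not_less)
    have inseparable: "\<not> separates X x y" if "x \<in> B" "y \<in> B" "X \<in> \<F>" for x y X
      using B that unfolding resulting_partition_def quotient_def separates_def by blast
    have BV: "B \<subseteq> verts D"
      using B by (auto simp: resulting_partition_def quotient_def)
    have "finite (verts K)" "card (verts K) = card S"
      using S assms(4) by (auto simp: complete_digraph_def)
    then obtain \<phi> where \<phi>: "bij_betw \<phi> (verts K) S"
      using S(3) finite_same_card_bij by blast
    have "immersed K D"
    proof (rule eulerian_immersed[where \<phi> = \<phi>])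
      show "inj_on \<phi> (verts K)" "\<phi> ` verts K \<subseteq> verts D"
        using \<phi> S BV by (auto simp: bij_betw_def)
      fix X u v
      assume X: "X \<subseteq> verts D" "u \<in> verts K" "v \<in> verts K" "separates X (\<phi> u) (\<phi> v)"
      have "\<phi> u \<in> B" "\<phi> v \<in> B" using \<phi> S X by (auto simp: bij_betw_def)
      \<comment> \<open>A smaller cut separating \<open>\<phi> u\<close> and \<open>\<phi> v\<close>
        would provide a member of \<open>\<F>\<close> separating two vertices of the block
        \<open>B\<close>. Half of the bound, the part in one direction, is the number of arcs of
        \<open>K\<close>.\<close>
      hence "2 * t * (t - 1) \<le> card (edge_cut D X)"
        using sep[of "\<phi> u" "\<phi> v" X] X BV inseparable by (meson not_less subsetD)
      thus "card (arcs K) \<le> card (out_cut D X)"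
        using complete_digraph_eulerian(2)[OF assms(4)] D.eulerian_card_edge_cut[OF assms(3) X(1)]
        by simp
    qed (use assms complete_digraph_eulerian in \<open>auto intro: K.fin_digraph\<close>)
    with assms(5) show False ..
  qed
  moreover have "laminar D \<F>"
    using \<F>(2) by (simp add: laminar_def cross_free_uncrossed)
  ultimately show ?thesis using \<F> by blast
qed

end
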